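(* Let $G$ be an essential labelled graph and let $L=\mathcal{L}(G)$ be its (central regular) language. Then $L$ is chain-transitive if and only if the linking graph $G/_\approx$ is connected.
   Context: Let $A$ be a finite alphabet. $A^{\mathbb Z}$ carries the metric $\rho(x,x)=0$ and, for $x\ne y$, $\rho(x,y)=2^{-n}$, where $n$ is the least nonnegative integer with $x_n\neq y_n$ or $x_{-n}\neq y_{-n}$. The shift is $\sigma(x)_i=x_{i+1}$. A subshift is a closed set $\Sigma\subseteq A^{\mathbb Z}$ with $\sigma(\Sigma)=\Sigma$; its language $\mathcal{L}(\Sigma)$ is the set of all finite factors (including the empty word) of elements of $\Sigma$. For $\epsilon>0$, an $\epsilon$-chain in $\Sigma$ of length $n>0$ from $x^0$ to $x^n$ is a sequence $x^0,\dots,x^n\in\Sigma$ with $\rho(\sigma(x^i),x^{i+1})<\epsilon$ for all $i=0,1,\dots,n-1$. $\Sigma$ is chain-transitive if for all $x,y\in\Sigma$ and every $\epsilon>0$ there is an $\epsilon$-chain in $\Sigma$ from $x$ to $y$. A language of the form $\mathcal{L}(\Sigma)$ is called chain-transitive if the subshift $\Sigma$ (which it determines uniquely) is chain-transitive. (A language is central if it is closed under factors and every $v$ in it has an extension $uvw$ in it with $u,w$ nonempty.) Labelled graphs. A labelled graph $G$ over $A$ is a finite directed multigraph (loops and parallel edges allowed) whose edges $e$ carry labels $l(e)\in A$. $\Sigma(G)$ is the subshift of all $x\in A^{\mathbb Z}$ for which there is a biinfinite walk with edges $(e_i)_{i\in\mathbb Z}$ in $G$ with $l(e_i)=x_i$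 for all $i$, and $\mathcal{L}(G)=\mathcal{L}(\Sigma(G))$. $G$ is essential if every vertex has at least one outgoing and at least one ingoing edge (a loop counts as both). "Connected" means strongly connected: for all vertices $u,v$ there is a walk from $u$ to $v$, walks of length zero being allowed. The components of a graph are its maximal connected subgraphs; each vertex lies in exactly one. Linking graph. For a vertex $v$ of $G$ lying in the component $K$ of $G$, the restricted follower set $F(v)$ is the set of all finite words spelled by the labels of walks starting at $v$ and staying in $K$. Vertices $v,w$ are linked, $v\sim w$, if $|F(v)\cap F(w)|=\infty$. Let $\approx$ be the transitive and reflexive closure of $\sim$. The linking graph $G/_\approx$ has as vertices the equivalence classes of $\approx$ on $V(G)$, and there is an edge labelled $a$ from class $X$ to class $Y$ iff there are $u\in X$, $v\in Y$ and an edge labelled $a$ from $u$ to $v$ in $G$. *)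

theory Defs
  imports
    "HOL-Analysis.Abstract_Metric_Spaces"
    "Graph_Theory.Digraph_Component"
begin

section \<open>Subshifts and chain-transitivity\<close>

text \<open>The finite alphabet is a type \<open>'a\<close> of class \<open>finite\<close>; this constraint is only imposed
  where it is needed, namely in theorems.\<close>

definition seq_dist :: "(int \<Rightarrow> 'a) \<Rightarrow> (int \<Rightarrow> 'a) \<Rightarrow> real" where
  "seq_dist x y =
    (if x = y then 0
     else (1 / 2) ^ (LEAST n::nat. x (int n) \<noteq> y (int n) \<or> x (- int n) \<noteq> y (- int n)))"

definition shift_map :: "(int \<Rightarrow> 'a) \<Rightarrow> (int \<Rightarrow> 'a)" where
  "shift_map x = (\<lambda>i. x (i + 1))"

definition subshift :: "(int \<Rightarrow> 'a) set \<Rightarrow> bool" where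
  "subshift S \<longleftrightarrow> closedin (Metric_space.mtopology UNIV seq_dist) S \<and> shift_map ` S = S"

definition factor :: "(int \<Rightarrow> 'a) \<Rightarrow> int \<Rightarrow> nat \<Rightarrow> 'a list" where
  "factor x i n = map (\<lambda>k. x (i + int k)) [0..<n]"

definition language :: "(int \<Rightarrow> 'a) set \<Rightarrow> 'a list set" where
  "language S = {factor x i n | x i n. x \<in> S}"

definition eps_chain ::
    "(int \<Rightarrow> 'a) set \<Rightarrow> real \<Rightarrow> nat \<Rightarrow> (nat \<Rightarrow> int \<Rightarrow> 'a) \<Rightarrow> (int \<Rightarrow> 'a) \<Rightarrow> (int \<Rightarrow> 'a) \<Rightarrow> bool" where
  "eps_chain S \<epsilon> n c x y \<longleftrightarrow>
     n > 0 \<and> (\<forall>i\<le>n. c i \<in> S) \<and> c 0 = x \<and> c n = y \<and>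
     (\<forall>i<n. seq_dist (shift_map (c i)) (c (i + 1)) < \<epsilon>)"

definition chain_transitive :: "(int \<Rightarrow> 'a) set \<Rightarrow> bool" where
  "chain_transitive S \<longleftrightarrow> (\<forall>x\<in>S. \<forall>y\<in>S. \<forall>\<epsilon>>0. \<exists>n c. eps_chain S \<epsilon> n c x y)"

text \<open>The subshift \<open>S\<close> below is determined by \<open>L\<close>; see \<open>language_inj\<close>.\<close>

definition chain_transitive_language :: "'a list set \<Rightarrow> bool" where
  "chain_transitive_language L \<longleftrightarrow> (\<exists>S. subshift S \<and> language S = L \<and> chain_transitive S)"


section \<open>Labelled graphs\<close>

text \<open>A labelled graph is a pair of \<open>G :: ('v, 'e) pre_digraph\<close> with \<open>fin_digraph G\<close> and a
  labelling \<open>l :: 'e \<Rightarrow> 'a\<close>, of which only the values on \<open>arcs G\<close> matter.\<close>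

definition biinfinite_walk :: "('v, 'e) pre_digraph \<Rightarrow> (int \<Rightarrow> 'e) \<Rightarrow> bool" where
  "biinfinite_walk G e \<longleftrightarrow> (\<forall>i. e i \<in> arcs G \<and> head G (e i) = tail G (e (i + 1)))"

definition graph_shift :: "('v, 'e) pre_digraph \<Rightarrow> ('e \<Rightarrow> 'a) \<Rightarrow> (int \<Rightarrow> 'a) set" where
  "graph_shift G l = {x. \<exists>e. biinfinite_walk G e \<and> (\<forall>i. l (e i) = x i)}"

definition graph_language :: "('v, 'e) pre_digraph \<Rightarrow> ('e \<Rightarrow> 'a) \<Rightarrow> 'a list set" where
  "graph_language G l = language (graph_shift G l)"

definition essential :: "('v, 'e) pre_digraph \<Rightarrow> bool" where
  "essential G \<longleftrightarrow> (\<forall>v\<in>verts G. out_arcs G v \<noteq> {} \<and> in_arcs G v \<noteq> {})"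

text \<open>The library's \<open>strongly_connected\<close> excludes the empty graph, and its \<open>connected\<close> ignores
  the direction of arcs.\<close>

definition walk_connected :: "('v, 'e) pre_digraph \<Rightarrow> bool" where
  "walk_connected G \<longleftrightarrow> (\<forall>u\<in>verts G. \<forall>v\<in>verts G. \<exists>p. pre_digraph.awalk G u p v)"

definition component :: "('v, 'e) pre_digraph \<Rightarrow> ('v, 'e) pre_digraph \<Rightarrow> bool" where
  "component G K \<longleftrightarrow> pre_digraph.max_subgraph G walk_connected K"


section \<open>The linking graph\<close>

definition follower_set :: "('v, 'e) pre_digraph \<Rightarrow> ('e \<Rightarrow> 'a) \<Rightarrow> 'v \<Rightarrow> 'a list set" where
  "follower_set G l v =
     {map l p | p w K. component G K \<and> v \<in> verts K \<and> pre_digraph.awalk K v p w}"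

definition linked :: "('v, 'e) pre_digraph \<Rightarrow> ('e \<Rightarrow> 'a) \<Rightarrow> 'v rel" where
  "linked G l = {(v, w). v \<in> verts G \<and> w \<in> verts G \<and>
     infinite (follower_set G l v \<inter> follower_set G l w)}"

definition linked_closure :: "('v, 'e) pre_digraph \<Rightarrow> ('e \<Rightarrow> 'a) \<Rightarrow> 'v rel" where
  "linked_closure G l = rtrancl_on (verts G) (linked G l)"

text \<open>An arc \<open>(X, a, Y)\<close> of the linking graph goes from \<open>X\<close> to \<open>Y\<close> and has label \<open>a\<close>.\<close>

definition linking_graph ::
    "('v, 'e) pre_digraph \<Rightarrow> ('e \<Rightarrow> 'a) \<Rightarrow> ('v set, 'v set \<times> 'a \<times> 'v set) pre_digraph" where
  "linking_graph G l =
    (let C = verts G // linked_closure G l in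
     \<lparr> verts = C,
       arcs = {(X, a, Y). X \<in> C \<and> Y \<in> C \<and>
                 (\<exists>e\<in>arcs G. tail G e \<in> X \<and> head G e \<in> Y \<and> l e = a)},
       tail = (\<lambda>(X, a, Y). X),
       head = (\<lambda>(X, a, Y). Y) \<rparr>)"


section \<open>Basic facts\<close>

lemma seq_dist_less_iff:
  "seq_dist x y < (1 / 2) ^ n \<longleftrightarrow> (\<forall>k\<le>n. x (int k) = y (int k) \<and> x (- int k) = y (- int k))"
proof (cases "x = y")
  case True
  then show ?thesis by (simp add: seq_dist_def)
next
  case False
  let ?P = "\<lambda>n::nat. x (int n) \<noteq> y (int n) \<or> x (- int n) \<noteq> y (- int n)"
  obtain i where "x i \<noteq> y i" using False by blast
  then have "?P (nat \<bar>i\<bar>)" by (cases "i \<ge> 0") auto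
  then have P: "?P (Least ?P)" by (rule LeastI)
  have "seq_dist x y < (1 / 2) ^ n \<longleftrightarrow> n < Least ?P"
    using False by (simp add: seq_dist_def power_strict_decreasing_iff)
  also have "\<dots> \<longleftrightarrow> (\<forall>k\<le>n. \<not> ?P k)"
  proof
    show "\<forall>k\<le>n. \<not> ?P k" if "n < Least ?P"
      using that not_less_Least[of _ ?P] by (meson le_less_trans)
    show "n < Least ?P" if "\<forall>k\<le>n. \<not> ?P k"
      using that P by (meson not_le_imp_less)
  qed
  finally show ?thesis by simp
qed

lemma seq_dist_values: "seq_dist x y = 0 \<or> (\<exists>n. seq_dist x y = (1 / 2) ^ n)"
  by (auto simp: seq_dist_def)

lemma seq_dist_nonneg: "0 \<le> seq_dist x y"
  by (simp add: seq_dist_def)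

lemma seq_dist_zero_iff: "seq_dist x y = 0 \<longleftrightarrow> x = y"
  by (simp add: seq_dist_def)

lemma seq_dist_commute: "seq_dist x y = seq_dist y x"
  unfolding seq_dist_def by (simp add: eq_commute)

lemma seq_dist_ultra: "seq_dist x z \<le> max (seq_dist x y) (seq_dist y z)"
proof (rule ccontr)
  assume "\<not> ?thesis"
  then have less: "seq_dist x y < seq_dist x z" "seq_dist y z < seq_dist x z" by auto
  then obtain n where n: "seq_dist x z = (1 / 2) ^ n"
    using seq_dist_values[of x z] seq_dist_nonneg[of x y] by auto
  have "seq_dist x y < (1 / 2) ^ n" "seq_dist y z < (1 / 2) ^ n"
    using less unfolding n by auto
  then have "seq_dist x z < (1 / 2) ^ n"
    unfolding seq_dist_less_iff by simp
  with n show False by simp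
qed

lemma Metric_space_seq_dist: "Metric_space UNIV seq_dist"
proof
  show "seq_dist x z \<le> seq_dist x y + seq_dist y z" for x y z :: "int \<Rightarrow> 'a"
    using seq_dist_ultra[of x z y] seq_dist_nonneg[of x y] seq_dist_nonneg[of y z] by simp
qed (auto simp: seq_dist_nonneg seq_dist_zero_iff seq_dist_commute)

lemma subshift_shift_closed:
  assumes "shift_map ` S = S" "x \<in> S"
  shows "(\<lambda>i. x (i + j)) \<in> S"
proof (induction j rule: int_induct[where k = 0])
  case base
  then show ?case using assms by simp
next
  case (step1 j)
  have "shift_map (\<lambda>i. x (i + j)) \<in> S" using step1 assms by blast
  then show ?case by (simp add: shift_map_def add_ac)
next
  case (step2 j)
  then obtain y where y: "y \<in> S" "shift_map y = (\<lambda>i. x (i + j))" using assms by (metis imageE)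
  have "y i = x (i + (j - 1))" for i
    using fun_cong[OF y(2), of "i - 1"] by (simp add: shift_map_def algebra_simps)
  then have "y = (\<lambda>i. x (i + (j - 1)))" by blast
  then show ?case using y(1) by simp
qed

lemma language_subset_imp:
  assumes S: "subshift S" and T: "subshift T" and sub: "language T \<subseteq> language S"
  shows "T \<subseteq> S"
proof
  interpret Metric_space UNIV seq_dist by (rule Metric_space_seq_dist)
  fix x assume x: "x \<in> T"
  have "\<exists>y\<in>S. seq_dist x y < r" if "r > 0" for r
  proof -
    obtain n where n: "(1 / 2) ^ n < r" using \<open>r > 0\<close> real_arch_pow_inv[of r "1/2"] by auto
    have "factor x (- int n) (2 * n + 1) \<in> language S"
      using x sub unfolding language_def by blast
    then obtain y j m where y: "y \<in> S" and eq: "factor x (- int n) (2 * n + 1) = factor y j m"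
      unfolding language_def by blast
    have m: "m = 2 * n + 1" using arg_cong[OF eq, of length] by (simp add: factor_def)
    have eq': "x (- int n + int k) = y (j + int k)" if "k < 2 * n + 1" for k
      using arg_cong[OF eq, of "\<lambda>w. w ! k"] that m by (simp add: factor_def del: upt_Suc)
    let ?y = "\<lambda>i. y (i + (j + int n))"
    have "x i = ?y i" if "\<bar>i\<bar> \<le> int n" for i
    proof -
      have "0 \<le> i + int n" "nat (i + int n) < 2 * n + 1" using that by linarith+
      then show ?thesis using eq'[of "nat (i + int n)"] by (simp add: algebra_simps)
    qed
    then have "seq_dist x ?y < (1 / 2) ^ n" unfolding seq_dist_less_iff by simp
    moreover have "?y \<in> S"
      using subshift_shift_closed[OF _ y] S unfolding subshift_def by blast
    ultimately show ?thesis using n by force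
  qed
  then have "x \<in> mtopology closure_of S"
    by (auto simp: metric_closure_of in_mball)
  then show "x \<in> S" using S by (simp add: subshift_def closure_of_closedin)
qed

lemma language_inj:
  assumes "subshift S" "subshift T" "language S = language T"
  shows "S = T"
  using assms language_subset_imp by (metis order_refl subset_antisym)

lemma (in wf_digraph) walk_connected_iff: "walk_connected G \<longleftrightarrow> verts G = {} \<or> strongly_connected G"
  by (auto simp: walk_connected_def strongly_connected_def reachable_awalk)

end

theory Submission
  imports Defs
begin

text \<open>
  Let \<open>A\<close> be the union of the adjacency relation of \<open>G\<close> and of \<open>linked\<close>. The linking graph is
  connected iff \<open>A\<^sup>*\<close> relates any two vertices of \<open>G\<close> (\<open>walk_connected_linking_graph_iff\<close>), and
  because \<open>graph_shift\<close> is a subshift (\<open>subshift_graph_shift\<close>, by compactness), chain-transitivity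
  of the language is chain-transitivity of \<open>graph_shift\<close>. After a translation, a chain of small
  error is a path in \<open>overlap_step\<close>: follow the shift, but replace the point at will outside the
  window of coordinates \<open>0, \<dots>, N - 1\<close>.

  If \<open>A\<^sup>*\<close> is total, chains exist because both parts of \<open>A\<close> can be crossed. Arcs are crossed by
  walking. Linked vertices \<open>u\<close> and \<open>w\<close> are crossed by a long word that can be read from both: while
  the window lies inside that word, the presentation from \<open>u\<close> is exchanged for the one from \<open>w\<close>;
  the latter is still in the component of \<open>w\<close> when the word ends, so it can return to \<open>w\<close> and
  continue arbitrarily (\<open>chain_leads_linked\<close>).

  Conversely, let \<open>S = A\<^sup>* `` {u}\<close>, and consider a chain from a point with a presentation that is
  at \<open>u\<close> at time 0 to a point with a presentation that is at \<open>w\<close> at the end of the window. There is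
  a length \<open>D\<close> such that two presentations of the same word of length \<open>D\<close> pass through linked
  vertices simultaneously (\<open>presentations_linked_in_window\<close>): each walk changes component only
  boundedly often, so both stay in their components during a common long interval. As \<open>S\<close> is closed
  under arcs and under \<open>linked\<close>, being in \<open>S\<close> passes from one presentation to the next one with a
  delay of at most \<open>D\<close>. Transferring at every step would accumulate these delays, but points that
  are \<open>D\<close> steps apart still overlap in a word of length \<open>D\<close> when \<open>N = 2 * D\<close>, and over \<open>D\<close> steps
  the passage of time makes up for the delay. Hence the last presentation is in \<open>S\<close> at the end of
  the window, that is, \<open>w \<in> S\<close>.
\<close>

section \<open>Chains and one-sided windows\<close>

definition overlap_step :: "(int \<Rightarrow> 'a) set \<Rightarrow> nat \<Rightarrow> (int \<Rightarrow> 'a) rel" where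
  "overlap_step S N = {(x, z). x \<in> S \<and> z \<in> S \<and> (\<forall>t. 0 \<le> t \<and> t < int N \<longrightarrow> x (t + 1) = z t)}"

text \<open>The metric compares the symmetric windows \<open>{- n..n}\<close>; translating both endpoints by \<open>n\<close>
  turns these into one-sided windows, for which a walk can be cut at the vertex reached at the end
  of the window.\<close>

lemma chain_transitive_iff_overlap_step:
  assumes shift: "shift_map ` S = S"
  shows "chain_transitive S \<longleftrightarrow> (\<forall>x\<in>S. \<forall>y\<in>S. \<forall>N. (x, y) \<in> (overlap_step S N)\<^sup>+)"
proof (intro iffI ballI allI)
  fix x y N
  assume "chain_transitive S" and xy: "x \<in> S" "y \<in> S"
  moreover have "(1 / 2 :: real) ^ N > 0" by simp
  ultimately obtain n c where c: "eps_chain S ((1 / 2) ^ N) n c x y"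
    unfolding chain_transitive_def by blast
  have "(c i, c (Suc i)) \<in> overlap_step S N" if "i < n" for i
  proof -
    have "seq_dist (shift_map (c i)) (c (i + 1)) < (1 / 2) ^ N" "c i \<in> S" "c (Suc i) \<in> S"
      using c that by (auto simp: eps_chain_def)
    then have *: "shift_map (c i) (int k) = c (Suc i) (int k)" if "k \<le> N" for k
      using that unfolding seq_dist_less_iff by simp
    have "c i (t + 1) = c (Suc i) t" if "0 \<le> t" "t < int N" for t
      using *[of "nat t"] that by (simp add: shift_map_def)
    then show ?thesis
      using \<open>c i \<in> S\<close> \<open>c (Suc i) \<in> S\<close> by (simp add: overlap_step_def)
  qed
  then have "(x, y) \<in> overlap_step S N ^^ n"
    using c unfolding relpow_fun_conv eps_chain_def by blast
  then show "(x, y) \<in> (overlap_step S N)\<^sup>+"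
    using c by (auto simp: trancl_power eps_chain_def)
next
  assume steps: "\<forall>x\<in>S. \<forall>y\<in>S. \<forall>N. (x, y) \<in> (overlap_step S N)\<^sup>+"
  show "chain_transitive S"
    unfolding chain_transitive_def
  proof (intro ballI allI impI)
    fix x y and \<epsilon> :: real
    assume xy: "x \<in> S" "y \<in> S" and "\<epsilon> > 0"
    then obtain n where n: "(1 / 2) ^ n < \<epsilon>" using real_arch_pow_inv[of \<epsilon> "1/2"] by auto
    let ?x = "\<lambda>i. x (i + - int n)" and ?y = "\<lambda>i. y (i + - int n)"
    have "?x \<in> S" "?y \<in> S" using subshift_shift_closed[OF shift] xy by blast+
    then have "(?x, ?y) \<in> (overlap_step S (2 * n + 1))\<^sup>+" using steps by blast
    then obtain k f where k: "k > 0" and f: "f 0 = ?x" "f k = ?y"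
      and st: "\<And>i. i < k \<Longrightarrow> (f i, f (Suc i)) \<in> overlap_step S (2 * n + 1)"
      unfolding trancl_power relpow_fun_conv by auto
    define c where "c i = (\<lambda>j. f i (j + int n))" for i
    have fS: "f i \<in> S" if "i \<le> k" for i
      using st[of i] that f \<open>?y \<in> S\<close> by (cases "i = k") (auto simp: overlap_step_def)
    have "eps_chain S \<epsilon> k c x y"
      unfolding eps_chain_def
    proof (intro conjI allI impI)
      show "c i \<in> S" if "i \<le> k" for i
        unfolding c_def using subshift_shift_closed[OF shift fS[OF that]] .
      show "seq_dist (shift_map (c i)) (c (i + 1)) < \<epsilon>" if "i < k" for i
      proof -
        have eq: "f i (t + 1) = f (Suc i) t" if "0 \<le> t" "t < int (2 * n + 1)" for t
          using st[OF \<open>i < k\<close>] that by (simp add: overlap_step_def)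
        have "shift_map (c i) j = c (i + 1) j" if "\<bar>j\<bar> \<le> int n" for j
          using eq[of "j + int n"] that by (simp add: c_def shift_map_def algebra_simps)
        then have "seq_dist (shift_map (c i)) (c (i + 1)) < (1 / 2) ^ n"
          unfolding seq_dist_less_iff by simp
        then show ?thesis using n by simp
      qed
    qed (use k f in \<open>auto simp: c_def\<close>)
    then show "\<exists>n c. eps_chain S \<epsilon> n c x y" by blast
  qed
qed

text \<open>Every step may exchange the coordinates outside the window, so it suffices to agree with the
  target inside the window after the last shift.\<close>

lemma overlap_steps_along_orbit:
  assumes shift: "shift_map ` S = S" and "x \<in> S" "z \<in> S" and "k > 0"
    and agree: "\<And>t. 0 \<le> t \<Longrightarrow> t < int N \<Longrightarrow> x (t + int k) = z t"
  shows "(x, z) \<in> (overlap_step S N)\<^sup>+"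
  using \<open>k > 0\<close> \<open>x \<in> S\<close> agree
proof (induction k arbitrary: x rule: nat_induct_non_zero)
  case 1
  then show ?case using \<open>z \<in> S\<close> by (auto simp: overlap_step_def)
next
  case (Suc k)
  have S: "shift_map x \<in> S" using shift Suc.prems by blast
  have "(shift_map x, z) \<in> (overlap_step S N)\<^sup>+"
    using S by (rule Suc.IH) (use Suc.prems(2) in \<open>auto simp: shift_map_def add_ac\<close>)
  moreover have "(x, shift_map x) \<in> overlap_step S N"
    using Suc.prems S by (simp add: overlap_step_def shift_map_def)
  ultimately show ?case by (rule trancl_into_trancl2[rotated])
qed

section \<open>Biinfinite walks\<close>

lemma biinfinite_walk_shift:
  assumes "biinfinite_walk G e"
  shows "biinfinite_walk G (\<lambda>i. e (i + j))"
proof -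
  have "i + 1 + j = i + j + 1" for i by simp
  then show ?thesis using assms unfolding biinfinite_walk_def by presburger
qed

lemma graph_shiftI: "biinfinite_walk G e \<Longrightarrow> (\<lambda>i. l (e i)) \<in> graph_shift G l"
  by (auto simp: graph_shift_def)

lemma shift_map_graph_shift: "shift_map ` graph_shift G l = graph_shift G l"
proof
  have "shift_map x \<in> graph_shift G l" if "x \<in> graph_shift G l" for x
    using that biinfinite_walk_shift[of G _ 1] unfolding graph_shift_def shift_map_def by fast
  then show "shift_map ` graph_shift G l \<subseteq> graph_shift G l" by blast
  have "x \<in> shift_map ` graph_shift G l" if "x \<in> graph_shift G l" for x
  proof
    show "x = shift_map (\<lambda>i. x (i + - 1))" by (simp add: shift_map_def)
    show "(\<lambda>i. x (i + - 1)) \<in> graph_shift G l"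
      using that biinfinite_walk_shift[of G _ "- 1"] unfolding graph_shift_def by fast
  qed
  then show "graph_shift G l \<subseteq> shift_map ` graph_shift G l" by blast
qed

lemma biinfinite_walk_paste:
  assumes e: "biinfinite_walk G e" and f: "biinfinite_walk G f" and "tail G (e a) = tail G (f 0)"
  shows "biinfinite_walk G (\<lambda>i. if i < a then e i else f (i - a))"
proof -
  have e': "e i \<in> arcs G" "head G (e i) = tail G (e (i + 1))"
    and f': "f i \<in> arcs G" "head G (f i) = tail G (f (i + 1))" for i
    using e f by (auto simp: biinfinite_walk_def)
  show ?thesis
    unfolding biinfinite_walk_def
  proof (intro allI conjI)
    fix i
    show "(if i < a then e i else f (i - a)) \<in> arcs G" using e' f' by simp
    consider "i + 1 < a" | "i + 1 = a" | "a \<le> i" by linarith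
    then show "head G (if i < a then e i else f (i - a)) =
        tail G (if i + 1 < a then e (i + 1) else f (i + 1 - a))"
      by cases (use assms(3) e'(2)[of i] f'(2)[of "i - a"] in \<open>auto simp: algebra_simps\<close>)
  qed
qed

context wf_digraph
begin

lemma biinfinite_walk_tail_in_verts: "biinfinite_walk G e \<Longrightarrow> tail G (e i) \<in> verts G"
  by (simp add: biinfinite_walk_def)

lemma essential_biinfinite_walk_from:
  assumes "essential G" "v \<in> verts G"
  obtains e where "biinfinite_walk G e" "tail G (e 0) = v"
proof -
  have "\<forall>u. \<exists>a. u \<in> verts G \<longrightarrow> a \<in> out_arcs G u" "\<forall>u. \<exists>a. u \<in> verts G \<longrightarrow> a \<in> in_arcs G u"
    using assms(1) unfolding essential_def by blast+
  then obtain nx pr where "\<And>u. u \<in> verts G \<Longrightarrow> nx u \<in> out_arcs G u"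
    and "\<And>u. u \<in> verts G \<Longrightarrow> pr u \<in> in_arcs G u" by metis
  then have nx: "\<And>u. u \<in> verts G \<Longrightarrow> nx u \<in> arcs G \<and> tail G (nx u) = u"
    and pr: "\<And>u. u \<in> verts G \<Longrightarrow> pr u \<in> arcs G \<and> head G (pr u) = u" by auto
  \<comment> \<open>the vertices visited to the right and to the left of \<open>v\<close>\<close>
  define R where "R k = ((\<lambda>u. head G (nx u)) ^^ k) v" for k
  define P where "P k = ((\<lambda>u. tail G (pr u)) ^^ k) v" for k
  have R: "R k \<in> verts G" for k
    by (induction k) (use assms(2) nx in \<open>auto simp: R_def\<close>)
  have P: "P k \<in> verts G" for k
    by (induction k) (use assms(2) pr in \<open>auto simp: P_def\<close>)
  define h where "h i = (if i \<ge> 0 then nx (R (nat i)) else pr (P (nat (- 1 - i))))" for i :: int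
  have "biinfinite_walk G h"
    unfolding biinfinite_walk_def
  proof (intro allI conjI)
    fix i
    show "h i \<in> arcs G" using nx pr R P by (simp add: h_def)
    consider "i \<ge> 0" | "i = - 1" | "i < - 1" by linarith
    then show "head G (h i) = tail G (h (i + 1))"
    proof cases
      case 1
      then have "nat (i + 1) = Suc (nat i)" by simp
      then show ?thesis using 1 nx[OF R[of "Suc (nat i)"]] by (simp add: h_def) (simp add: R_def)
    next
      case 2
      then show ?thesis using nx pr assms(2) by (simp add: h_def R_def P_def)
    next
      case 3
      then have "nat (- 1 - i) = Suc (nat (- 1 - (i + 1)))" by simp
      then show ?thesis using 3 pr[OF P[of "nat (- 1 - i)"]]
        by (simp add: h_def) (simp add: P_def)
    qed
  qed
  moreover have "tail G (h 0) = v" using nx assms(2) by (simp add: h_def R_def)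
  ultimately show thesis using that by blast
qed

lemma awalk_extend_biinfinite_walk:
  assumes ess: "essential G" and "awalk u p v" and f: "biinfinite_walk G f" "tail G (f 0) = v"
  obtains e where "biinfinite_walk G e" "tail G (e 0) = u"
    "\<And>k. k < length p \<Longrightarrow> e (int k) = p ! k" "\<And>i. i \<ge> 0 \<Longrightarrow> e (i + int (length p)) = f i"
  using assms(2)
proof (induction p arbitrary: u thesis)
  case Nil
  then show ?case using f by (auto simp: awalk_Nil_iff)
next
  case (Cons a p)
  then have a: "a \<in> arcs G" "tail G a = u" and p: "awalk (head G a) p v"
    by (auto simp: awalk_Cons_iff)
  obtain e where e: "biinfinite_walk G e" "tail G (e 0) = head G a"
    "\<And>k. k < length p \<Longrightarrow> e (int k) = p ! k" "\<And>i. i \<ge> 0 \<Longrightarrow> e (i + int (length p)) = f i"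
    using Cons.IH[OF _ p] by blast
  obtain h where h: "biinfinite_walk G h" "tail G (h 0) = u"
    using essential_biinfinite_walk_from[OF ess] a by (metis tail_in_verts)
  define g where "g i = (if i < 0 then h i else if i = 0 then a else e (i - 1))" for i
  have "biinfinite_walk G g"
    unfolding biinfinite_walk_def
  proof (intro allI conjI)
    fix i
    have e': "e i \<in> arcs G" "head G (e i) = tail G (e (i + 1))"
      and h': "h i \<in> arcs G" "head G (h i) = tail G (h (i + 1))" for i
      using e h by (auto simp: biinfinite_walk_def)
    show "g i \<in> arcs G" using e' h' a by (simp add: g_def)
    consider "i < - 1" | "i = - 1" | "i = 0" | "i > 0" by linarith
    then show "head G (g i) = tail G (g (i + 1))"
      by cases (use a h(2) h'(2)[of i] e(2) e'(2)[of "i - 1"] in \<open>auto simp: g_def\<close>)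
  qed
  moreover have "tail G (g 0) = u" using a by (simp add: g_def)
  moreover have "g (int k) = (a # p) ! k" if "k < length (a # p)" for k
    using that e(3)[of "k - 1"] by (cases k) (auto simp: g_def)
  moreover have "g (i + int (length (a # p))) = f i" if "i \<ge> 0" for i
    using that e(4)[OF that] by (simp add: g_def add_ac)
  ultimately show ?case using Cons.prems(1) by blast
qed

lemma awalk_biinfinite_walk_segment:
  assumes "biinfinite_walk G e"
  shows "awalk (tail G (e a)) (map (\<lambda>k. e (a + int k)) [0..<n]) (tail G (e (a + int n)))"
proof (induction n)
  case 0
  then show ?case using assms by (simp add: awalk_Nil_iff biinfinite_walk_tail_in_verts)
next
  case (Suc n)
  have "head G (e (a + int n)) = tail G (e (a + int (Suc n)))"
    using assms unfolding biinfinite_walk_def by (metis add.assoc of_nat_Suc add.commute)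
  then have "awalk (tail G (e (a + int n))) [e (a + int n)] (tail G (e (a + int (Suc n))))"
    using assms by (simp add: awalk_simps biinfinite_walk_def)
  from awalk_appendI[OF Suc this] show ?case by simp
qed

lemma biinfinite_walk_reachable:
  assumes "biinfinite_walk G e" "a \<le> b"
  shows "tail G (e a) \<rightarrow>\<^sup>* tail G (e b)"
  using awalk_biinfinite_walk_segment[OF assms(1), of a "nat (b - a)"] assms(2)
  by (auto simp: reachable_awalk)

end

section \<open>The shift presented by a finite graph is closed\<close>

text \<open>The walks presenting \<open>x\<close> on \<open>{- n..n}\<close> form a decreasing sequence of closed subsets of the
  compact space \<open>arcs G\<^sup>\<int>\<close>. If \<open>x\<close> has no presentation, their intersection is empty, so one of
  them is empty, and then no point close to \<open>x\<close> has a presentation.\<close>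

lemma (in fin_digraph) subshift_graph_shift: "subshift (graph_shift G l)"
  unfolding subshift_def
proof
  show "shift_map ` graph_shift G l = graph_shift G l" by (rule shift_map_graph_shift)
  interpret Metric_space UNIV seq_dist by (rule Metric_space_seq_dist)
  define X where "X = product_topology (\<lambda>_::int. discrete_topology (arcs G)) UNIV"
  have top: "topspace X = {e. \<forall>i. e i \<in> arcs G}" by (auto simp: X_def PiE_def)
  have compact: "compact_space X"
    unfolding X_def compact_space_product_topology by (simp add: compact_space_discrete_topology)
  have clo: "closedin X {e \<in> topspace X. P (e i)}" for i and P :: "'b \<Rightarrow> bool"
  proof -
    have "continuous_map X (discrete_topology (arcs G)) (\<lambda>e. e i)"
      unfolding X_def by (rule continuous_map_product_projection) simp
    then have "closedin X {e \<in> topspace X. e i \<in> {a \<in> arcs G. P a}}"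
      by (rule closedin_continuous_map_preimage) auto
    moreover have "{e \<in> topspace X. e i \<in> {a \<in> arcs G. P a}} = {e \<in> topspace X. P (e i)}"
      by (auto simp: top)
    ultimately show ?thesis by simp
  qed
  show "closedin mtopology (graph_shift G l)"
    unfolding closedin_metric
  proof (intro conjI allI impI)
    fix x assume x: "x \<in> UNIV - graph_shift G l"
    define C where "C n = {e. biinfinite_walk G e \<and> (\<forall>i. \<bar>i\<bar> \<le> int n \<longrightarrow> l (e i) = x i)}" for n
    have "closedin X (C n)" for n
    proof -
      \<comment> \<open>consecutive arcs are matched through their common vertex, so that each condition
        depends on a single coordinate\<close>
      have "closedin X ((\<Inter>i. \<Union>v\<in>verts G. {e \<in> topspace X. head G (e i) = v}
            \<inter> {e \<in> topspace X. tail G (e (i + 1)) = v})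
          \<inter> (\<Inter>i\<in>{i. \<bar>i\<bar> \<le> int n}. {e \<in> topspace X. l (e i) = x i}))"
        using clo[of "\<lambda>a. head G a = _"] clo[of "\<lambda>a. tail G a = _"] clo[of "\<lambda>a. l a = _"]
        by (intro closedin_Int closedin_INT closedin_Union finite_imageI)
          (auto intro!: closedin_Int exI[of _ 0])
      moreover have "\<dots> = C n"
        by (auto simp: C_def top biinfinite_walk_def)
      ultimately show ?thesis by simp
    qed
    moreover have "decseq C"
      by (auto simp: decseq_def C_def)
    moreover have "(\<Inter>n. C n) = {}"
    proof -
      have False if "\<And>n. e \<in> C n" for e
      proof -
        have "l (e i) = x i" for i
          using that[of "nat \<bar>i\<bar>"] by (simp add: C_def)
        then have "x \<in> graph_shift G l"
          using that by (auto simp: graph_shift_def C_def)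
        then show False using x by blast
      qed
      then show ?thesis by blast
    qed
    ultimately obtain n where "C n = {}"
      using compact_space_imp_nest[OF compact] by blast
    have "y \<notin> graph_shift G l" if "seq_dist x y < (1 / 2) ^ n" for y
    proof
      assume "y \<in> graph_shift G l"
      then obtain e where e: "biinfinite_walk G e" "\<And>i. l (e i) = y i"
        by (auto simp: graph_shift_def)
      have "l (e i) = x i" if "\<bar>i\<bar> \<le> int n" for i
      proof -
        have "\<forall>k\<le>n. x (int k) = y (int k) \<and> x (- int k) = y (- int k)"
          using \<open>seq_dist x y < (1 / 2) ^ n\<close> unfolding seq_dist_less_iff .
        then have "x i = y i" using that by (cases "i \<ge> 0") (auto dest: spec[of _ "nat \<bar>i\<bar>"])
        then show ?thesis using e by simp
      qed
      then have "e \<in> C n" using e by (simp add: C_def)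
      then show False using \<open>C n = {}\<close> by blast
    qed
    then have "disjnt (graph_shift G l) (mball x ((1 / 2) ^ n))"
      by (auto simp: disjnt_def in_mball)
    then show "\<exists>r>0. disjnt (graph_shift G l) (mball x r)"
      by (intro exI[of _ "(1 / 2) ^ n"]) simp
  qed simp
qed


section \<open>Long common words and linked vertices\<close>

context wf_digraph
begin

lemma component_exists:
  assumes "v \<in> verts G"
  obtains K where "component G K" "verts K = scc_of v" "induced_subgraph K G"
proof
  let ?K = "G \<restriction> scc_of v"
  have "scc_of v \<in> sccs_verts" using assms by (rule scc_of_in_sccs_verts)
  then have "?K \<in> sccs" unfolding sccs_conv_sccs_verts by (rule imageI)
  then have ind: "induced_subgraph ?K G" and sc: "strongly_connected ?K" by auto
  then interpret K: wf_digraph ?K by (auto dest: wf_digraphI_induced)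
  show "induced_subgraph ?K G" by (rule ind)
  show "verts ?K = scc_of v" by simp
  have v: "v \<in> scc_of v" using assms by (rule in_scc_of_self)
  have "H = ?K" if KH: "subgraph ?K H" and HG: "subgraph H G" and conn: "walk_connected H" for H
  proof -
    interpret H: wf_digraph H using HG by (auto simp: subgraph_def)
    have vH: "v \<in> verts H" using v KH by (auto simp: subgraph_def)
    have "u \<in> scc_of v" if "u \<in> verts H" for u
    proof -
      have "\<exists>p. H.awalk v p u" "\<exists>p. H.awalk u p v"
        using conn that vH by (auto simp: walk_connected_def)
      then show ?thesis
        using subgraph_awalk_imp_awalk[OF _ HG] unfolding scc_of_def reachable_awalk by blast
    qed
    then have verts: "verts H = verts ?K" using KH by (auto simp: subgraph_def)
    have "tail H = tail G" "head H = head G" using HG by (auto simp: subgraph_def compatible_def)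
    then have "arcs H \<subseteq> arcs ?K"
      using HG verts H.wellformed by (auto simp: subgraph_def)
    then have "arcs H = arcs ?K" using KH by (auto simp: subgraph_def)
    then show ?thesis using verts \<open>tail H = tail G\<close> \<open>head H = head G\<close> by auto
  qed
  moreover have "walk_connected ?K" using sc by (simp add: K.walk_connected_iff)
  ultimately show "component G ?K"
    using ind unfolding component_def max_subgraph_def by blast
qed

text \<open>A walk that can return to its start never leaves the component of that vertex, since every
  vertex on it is reachable from the start and reaches the start.\<close>

lemma follower_set_eq:
  "follower_set G l v = {map l p | p w. awalk v p w \<and> w \<rightarrow>\<^sup>* v}"
proof (intro equalityI subsetI)
  fix s assume "s \<in> follower_set G l v"
  then obtain p w K where K: "component G K" "v \<in> verts K" "pre_digraph.awalk K v p w"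
    and s: "s = map l p" by (auto simp: follower_set_def)
  then have sub: "subgraph K G" and conn: "walk_connected K"
    by (auto simp: component_def max_subgraph_def)
  interpret K: wf_digraph K using sub by (auto simp: subgraph_def)
  have "w \<in> verts K" using K(3) by (rule K.awalk_last_in_verts)
  then obtain q where "K.awalk w q v" using conn K(2) by (auto simp: walk_connected_def)
  then show "s \<in> {map l p | p w. awalk v p w \<and> w \<rightarrow>\<^sup>* v}"
    using subgraph_awalk_imp_awalk[OF _ sub] K(3) s unfolding reachable_awalk by blast
next
  fix s assume "s \<in> {map l p | p w. awalk v p w \<and> w \<rightarrow>\<^sup>* v}"
  then obtain p w where p: "awalk v p w" "w \<rightarrow>\<^sup>* v" and s: "s = map l p" by blast
  have v: "v \<in> verts G" using p by (auto dest: awalk_hd_in_verts)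
  then obtain K where K: "component G K" "verts K = scc_of v" "induced_subgraph K G"
    by (rule component_exists)
  interpret K: wf_digraph K using K(3) by (rule wf_digraphI_induced)
  have KG: "tail G = tail K" "head G = head K"
      "arcs K = {e \<in> arcs G. tail G e \<in> verts K \<and> head G e \<in> verts K}"
    using K(3) unfolding induced_subgraph_def subgraph_def compatible_def by blast+
  have "K.awalk u p w" if "awalk u p w" "v \<rightarrow>\<^sup>* u" for u
    using that
  proof (induction p arbitrary: u)
    case Nil
    then have "u = w" by (simp add: awalk_Nil_iff)
    moreover have "w \<in> verts K" using Nil.prems(2) p(2) \<open>u = w\<close> unfolding K(2) scc_of_def by blast
    ultimately show ?case unfolding K.awalk_Nil_iff by blast
  next
    case (Cons a p)
    then have a: "a \<in> arcs G" "u = tail G a" "awalk (head G a) p w" by (auto simp: awalk_Cons_iff)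
    have va: "v \<rightarrow>\<^sup>* head G a"
      using Cons.prems(2) a reachable_adj_trans in_arcs_imp_in_arcs_ends by blast
    have "head G a \<rightarrow>\<^sup>* v" using a(3) p(2) reachable_awalkI reachable_trans by blast
    moreover have "u \<rightarrow>\<^sup>* v" using Cons.prems(1) p(2) reachable_awalkI reachable_trans by blast
    ultimately have "a \<in> arcs K"
      using a(1,2) va Cons.prems(2) unfolding KG(3) K(2) scc_of_def by blast
    then show ?case using Cons.IH[OF a(3) va] a unfolding K.awalk_Cons_iff KG(1,2) by blast
  qed
  then have "K.awalk v p w" using p v by simp
  moreover have "v \<in> verts K" using v unfolding K(2) by (rule in_scc_of_self)
  ultimately show "s \<in> follower_set G l v" using K(1) s unfolding follower_set_def by blast
qed

end

lemma infinite_imp_long_word: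
  fixes W :: "'a::finite list set"
  assumes "infinite W"
  obtains s where "s \<in> W" "length s \<ge> n"
proof -
  have "finite {s :: 'a list. set s \<subseteq> UNIV \<and> length s \<le> n}"
    by (rule finite_lists_length_le) simp
  then have "\<not> W \<subseteq> {s. length s \<le> n}" using assms by (auto dest: finite_subset)
  then show thesis using that by fastforce
qed

text \<open>The finitely many pairs that are not linked have finitely many common words altogether.\<close>

lemma (in fin_digraph) linked_if_common_long_word:
  obtains M where "M > 0"
    "\<And>v w s. \<lbrakk>v \<in> verts G; w \<in> verts G; s \<in> follower_set G l v \<inter> follower_set G l w; length s \<ge> M\<rbrakk>
      \<Longrightarrow> (v, w) \<in> linked G l"
proof -
  let ?W = "\<Union>(v, w)\<in>verts G \<times> verts G - linked G l. follower_set G l v \<inter> follower_set G l w"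
  have "finite ?W"
    by (intro finite_UN_I) (auto simp: linked_def)
  then have fin: "finite (length ` ?W)" by simp
  show thesis
  proof (rule that[of "Suc (Max (insert 0 (length ` ?W)))"])
    fix v w s
    assume *: "v \<in> verts G" "w \<in> verts G" "s \<in> follower_set G l v \<inter> follower_set G l w"
      and len: "Suc (Max (insert 0 (length ` ?W))) \<le> length s"
    show "(v, w) \<in> linked G l"
    proof (rule ccontr)
      assume "(v, w) \<notin> linked G l"
      then have "s \<in> ?W" using * by blast
      then have "length s \<le> Max (insert 0 (length ` ?W))" using fin by (intro Max_ge) auto
      then show False using len by simp
    qed
  qed simp
qed

lemma linked_sym: "sym (linked G l)"
  by (auto simp: linked_def sym_def Int_commute)

lemma nonincreasing_nat_stationary:
  fixes g :: "nat \<Rightarrow> nat"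
  assumes "\<And>k. g (Suc k) \<le> g k"
  obtains j where "j \<le> g 0" "g (Suc j) = g j"
proof (rule ccontr)
  assume "\<not> thesis"
  then have less: "g (Suc j) < g j" if "j \<le> g 0" for j
    using that assms[of j] \<open>\<And>j. _ \<Longrightarrow> _ \<Longrightarrow> thesis\<close> by (meson le_neq_implies_less)
  have "g j + j \<le> g 0" if "j \<le> Suc (g 0)" for j
    using that
  proof (induction j)
    case (Suc j)
    then show ?case using less[of j] by simp
  qed simp
  from this[of "Suc (g 0)"] show False by simp
qed

text \<open>The set of vertices reachable from the current position of a walk can only shrink, and a walk
  stays in its component exactly while this set is constant. Adding up the two cardinalities gives
  an interval on which both walks stay in their components.\<close>

lemma (in fin_digraph) biinfinite_walks_recurrent_interval:
  assumes e: "biinfinite_walk G e" and f: "biinfinite_walk G f"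
  obtains j where "j \<le> 2 * card (verts G)"
    "tail G (e (a + int (Suc j * M))) \<rightarrow>\<^sup>* tail G (e (a + int (j * M)))"
    "tail G (f (b + int (Suc j * M))) \<rightarrow>\<^sup>* tail G (f (b + int (j * M)))"
proof -
  define R where "R v = {u. v \<rightarrow>\<^sup>* u}" for v
  have fin: "finite (R v)" for v
    by (rule finite_subset[OF _ finite_verts]) (auto simp: R_def reachable_in_verts)
  have le: "card (R v) \<le> card (verts G)" for v
    by (rule card_mono) (auto simp: R_def reachable_in_verts)
  define A where "A j = R (tail G (e (a + int (j * M))))" for j
  define B where "B j = R (tail G (f (b + int (j * M))))" for j
  have A: "A (Suc j) \<subseteq> A j" and B: "B (Suc j) \<subseteq> B j" for j
    using biinfinite_walk_reachable[OF e, of "a + int (j * M)" "a + int (Suc j * M)"]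
      biinfinite_walk_reachable[OF f, of "b + int (j * M)" "b + int (Suc j * M)"]
    by (auto simp: A_def B_def R_def intro: reachable_trans)
  have finAB: "finite (A j)" "finite (B j)" for j using fin by (auto simp: A_def B_def)
  have "card (A (Suc j)) + card (B (Suc j)) \<le> card (A j) + card (B j)" for j
    by (intro add_mono card_mono A B finAB)
  then obtain j where j: "j \<le> card (A 0) + card (B 0)"
    and eq: "card (A (Suc j)) + card (B (Suc j)) = card (A j) + card (B j)"
    by (rule nonincreasing_nat_stationary[of "\<lambda>j. card (A j) + card (B j)"])
  have "card (A (Suc j)) = card (A j)" "card (B (Suc j)) = card (B j)"
    using eq card_mono[OF finAB(1) A[of j]] card_mono[OF finAB(2) B[of j]] by linarith+
  then have "A (Suc j) = A j" "B (Suc j) = B j"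
    using card_subset_eq[OF finAB(1) A[of j]] card_subset_eq[OF finAB(2) B[of j]] by simp_all
  moreover have "tail G (e (a + int (j * M))) \<in> A j" "tail G (f (b + int (j * M))) \<in> B j"
    using e f by (simp_all add: A_def B_def R_def biinfinite_walk_tail_in_verts)
  ultimately have "tail G (e (a + int (j * M))) \<in> A (Suc j)" "tail G (f (b + int (j * M))) \<in> B (Suc j)"
    by simp_all
  moreover have "j \<le> 2 * card (verts G)"
    using j le[of "tail G (e (a + int (0 * M)))"] le[of "tail G (f (b + int (0 * M)))"]
    unfolding A_def B_def by linarith
  ultimately show thesis using that[of j] unfolding A_def B_def R_def by blast
qed

lemma (in fin_digraph) presentations_linked_in_window:
  obtains D where "D > 0"
    "\<And>e f a b. \<lbrakk>biinfinite_walk G e; biinfinite_walk G f;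
        \<And>s. 0 \<le> s \<Longrightarrow> s < int D \<Longrightarrow> l (e (a + s)) = l (f (b + s))\<rbrakk>
      \<Longrightarrow> \<exists>s. 0 \<le> s \<and> s \<le> int D \<and> (tail G (e (a + s)), tail G (f (b + s))) \<in> linked G l"
proof -
  obtain M where M: "M > 0"
    "\<And>v w s. \<lbrakk>v \<in> verts G; w \<in> verts G; s \<in> follower_set G l v \<inter> follower_set G l w; length s \<ge> M\<rbrakk>
      \<Longrightarrow> (v, w) \<in> linked G l"
    using linked_if_common_long_word by blast
  define D where "D = Suc (2 * card (verts G)) * M"
  show thesis
  proof (rule that[of D])
    show "D > 0" using M by (simp add: D_def)
    fix e f a b
    assume e: "biinfinite_walk G e" and f: "biinfinite_walk G f"
      and agree: "\<And>s. 0 \<le> s \<Longrightarrow> s < int D \<Longrightarrow> l (e (a + s)) = l (f (b + s))"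
    obtain j where j: "j \<le> 2 * card (verts G)"
      and re: "tail G (e (a + int (Suc j * M))) \<rightarrow>\<^sup>* tail G (e (a + int (j * M)))"
      and rf: "tail G (f (b + int (Suc j * M))) \<rightarrow>\<^sup>* tail G (f (b + int (j * M)))"
      using biinfinite_walks_recurrent_interval[OF e f] by blast
    have jD: "Suc j * M \<le> D" unfolding D_def using j by (intro mult_le_mono) auto
    let ?p = "map (\<lambda>k. e (a + int (j * M) + int k)) [0..<M]"
    let ?q = "map (\<lambda>k. f (b + int (j * M) + int k)) [0..<M]"
    have "awalk (tail G (e (a + int (j * M)))) ?p (tail G (e (a + int (Suc j * M))))"
      using awalk_biinfinite_walk_segment[OF e, of "a + int (j * M)" M] by (simp add: algebra_simps)
    then have 1: "map l ?p \<in> follower_set G l (tail G (e (a + int (j * M))))"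
      using re unfolding follower_set_eq by blast
    have "awalk (tail G (f (b + int (j * M)))) ?q (tail G (f (b + int (Suc j * M))))"
      using awalk_biinfinite_walk_segment[OF f, of "b + int (j * M)" M] by (simp add: algebra_simps)
    then have 2: "map l ?q \<in> follower_set G l (tail G (f (b + int (j * M))))"
      using rf unfolding follower_set_eq by blast
    have "l (e (a + int (j * M) + int k)) = l (f (b + int (j * M) + int k))" if "k < M" for k
    proof -
      have "j * M + k < D" using that jD by simp
      then have "int (j * M) + int k < int D" by linarith
      then show ?thesis using agree[of "int (j * M) + int k"] by (simp add: add.assoc)
    qed
    then have eq: "map l ?p = map l ?q" by simp
    have "map l ?p \<in> follower_set G l (tail G (e (a + int (j * M))))
        \<inter> follower_set G l (tail G (f (b + int (j * M))))"
      using 1 2 unfolding eq[symmetric] by (rule IntI)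
    then have "(tail G (e (a + int (j * M))), tail G (f (b + int (j * M)))) \<in> linked G l"
      using e f by (intro M(2)[of _ _ "map l ?p"]) (auto simp: biinfinite_walk_tail_in_verts)
    moreover have "int (j * M) \<le> int D" unfolding of_nat_le_iff using jD by simp
    ultimately show "\<exists>s. 0 \<le> s \<and> s \<le> int D \<and> (tail G (e (a + s)), tail G (f (b + s))) \<in> linked G l"
      by (intro exI[of _ "int (j * M)"]) simp
  qed
qed

section \<open>Connectedness of the linking graph\<close>

lemma equiv_linked_closure: "equiv (verts G) (linked_closure G l)"
  unfolding linked_closure_def
proof (rule equivI)
  show "refl_on (verts G) (rtrancl_on (verts G) (linked G l))" by (auto simp: refl_on_def)
  show "rtrancl_on (verts G) (linked G l) \<subseteq> verts G \<times> verts G" by (auto dest: in_rtrancl_on_in_F)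
  show "sym (rtrancl_on (verts G) (linked G l))" by (rule rtrancl_on_sym[OF linked_sym])
  show "trans (rtrancl_on (verts G) (linked G l))"
    by (rule transI) (rule rtrancl_on_trans)
qed

lemma walk_connected_linking_graph_iff:
  assumes "wf_digraph G"
  shows "walk_connected (linking_graph G l) \<longleftrightarrow>
    (\<forall>u\<in>verts G. \<forall>w\<in>verts G. (u, w) \<in> (arcs_ends G \<union> linked G l)\<^sup>*)"
proof -
  interpret wf_digraph G by fact
  define LG where "LG = linking_graph G l"
  let ?E = "linked_closure G l" and ?A = "arcs_ends G \<union> linked G l"
  have eq: "equiv (verts G) ?E" by (rule equiv_linked_closure)
  interpret L: wf_digraph LG
    by unfold_locales (auto simp: LG_def linking_graph_def Let_def)
  have vL: "verts LG = verts G // ?E" by (simp add: LG_def linking_graph_def Let_def)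
  have tailL: "tail LG (X, b, Y) = X" and headL: "head LG (X, b, Y) = Y" for X b Y
    by (simp_all add: LG_def linking_graph_def Let_def)
  have EA: "(u, w) \<in> ?A\<^sup>*" if "X \<in> verts LG" "u \<in> X" "w \<in> X" for u w X
  proof -
    have "(u, w) \<in> ?E" using in_quotient_imp_in_rel[OF eq] that vL by blast
    then have "(u, w) \<in> (linked G l)\<^sup>*" unfolding linked_closure_def by (rule rtrancl_on_rtranclI)
    then show ?thesis by (rule rtrancl_mono[THEN subsetD, rotated]) simp
  qed
  have down: "(u, w) \<in> ?A\<^sup>*" if "X \<rightarrow>\<^sup>*\<^bsub>LG\<^esub> Y" "u \<in> X" "w \<in> Y" for X Y u w
    using that
  proof (induction arbitrary: u rule: L.converse_reachable_induct)
    case base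
    then show ?case using EA by blast
  next
    case (step X X')
    then obtain a where a: "a \<in> arcs G" "tail G a \<in> X" "head G a \<in> X'" "X \<in> verts LG"
      by (auto simp: arcs_ends_def arc_to_ends_def LG_def linking_graph_def Let_def)
    then have "(u, tail G a) \<in> ?A\<^sup>*" using EA step.prems by blast
    moreover have "(tail G a, head G a) \<in> ?A" using a in_arcs_imp_in_arcs_ends by blast
    moreover have "(head G a, w) \<in> ?A\<^sup>*" using step a by blast
    ultimately show ?case by (meson converse_rtrancl_into_rtrancl rtrancl_trans)
  qed
  have up: "(?E `` {u}) \<rightarrow>\<^sup>*\<^bsub>LG\<^esub> (?E `` {w})" if "(u, w) \<in> ?A\<^sup>*" "u \<in> verts G" for u w
    using that
  proof (induction rule: rtrancl_induct)
    case base
    then show ?case by (auto simp: vL intro: quotientI)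
  next
    case (step y z)
    show ?case
    proof (cases "(y, z) \<in> linked G l")
      case True
      then have "(y, z) \<in> ?E" unfolding linked_closure_def
        by (auto simp: linked_def intro: rtrancl_on_into_rtrancl_on)
      then show ?thesis using step equiv_class_eq[OF eq] by metis
    next
      case False
      then obtain a where a: "a \<in> arcs G" "tail G a = y" "head G a = z"
        using step(2) by (auto simp: arcs_ends_def arc_to_ends_def)
      then have yz: "y \<in> verts G" "z \<in> verts G" by auto
      then have "y \<in> ?E `` {y}" "z \<in> ?E `` {z}" using equiv_class_self[OF eq] by blast+
      then have "(?E `` {y}, l a, ?E `` {z}) \<in> arcs LG"
        using a yz by (auto simp: LG_def linking_graph_def Let_def intro: quotientI)
      then have "(?E `` {y}) \<rightarrow>\<^bsub>LG\<^esub> (?E `` {z})"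
        using L.in_arcs_imp_in_arcs_ends tailL headL by metis
      then show ?thesis using step by (blast intro: L.reachable_adj_trans)
    qed
  qed
  show ?thesis
    unfolding LG_def[symmetric]
  proof (intro iffI ballI)
    fix u w assume conn: "walk_connected LG" and uw: "u \<in> verts G" "w \<in> verts G"
    then have "(?E `` {u}) \<rightarrow>\<^sup>*\<^bsub>LG\<^esub> (?E `` {w})"
      unfolding walk_connected_def L.reachable_awalk vL by (auto intro: quotientI)
    moreover have "u \<in> ?E `` {u}" "w \<in> ?E `` {w}" using equiv_class_self[OF eq] uw by blast+
    ultimately show "(u, w) \<in> ?A\<^sup>*" using down by blast
  next
    assume *: "\<forall>u\<in>verts G. \<forall>w\<in>verts G. (u, w) \<in> ?A\<^sup>*"
    have "X \<rightarrow>\<^sup>*\<^bsub>LG\<^esub> Y" if XY: "X \<in> verts LG" "Y \<in> verts LG" for X Y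
    proof -
      obtain u where u: "X = ?E `` {u}" "u \<in> verts G"
        using XY(1) unfolding vL quotient_def by blast
      obtain w where w: "Y = ?E `` {w}" "w \<in> verts G"
        using XY(2) unfolding vL quotient_def by blast
      show ?thesis unfolding u(1) w(1) by (rule up) (use u(2) w(2) * in blast)+
    qed
    then show "walk_connected LG" by (simp add: walk_connected_def L.reachable_awalk)
  qed
qed


section \<open>A connected linking graph makes the shift chain-transitive\<close>

text \<open>The point at \<open>w\<close> is arbitrary while the one at \<open>u\<close> may be chosen: this asymmetry makes the
  relation transitive, and it is no loss because a chain can prescribe the future of a point beyond
  the window.\<close>

definition chain_leads ::
    "('v, 'e) pre_digraph \<Rightarrow> ('e \<Rightarrow> 'a) \<Rightarrow> nat \<Rightarrow> 'v \<Rightarrow> 'v \<Rightarrow> bool" where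
  "chain_leads G l N u w \<longleftrightarrow>
    (\<forall>f. biinfinite_walk G f \<and> tail G (f 0) = w \<longrightarrow>
      (\<exists>e. biinfinite_walk G e \<and> tail G (e 0) = u \<and>
        ((\<lambda>i. l (e i)), (\<lambda>i. l (f i))) \<in> (overlap_step (graph_shift G l) N)\<^sup>*))"

lemma chain_leads_refl: "chain_leads G l N u u"
  unfolding chain_leads_def by blast

lemma chain_leads_trans:
  assumes uv: "chain_leads G l N u v" and vw: "chain_leads G l N v w"
  shows "chain_leads G l N u w"
  unfolding chain_leads_def
proof (intro allI impI)
  let ?R = "overlap_step (graph_shift G l) N"
  fix f assume "biinfinite_walk G f \<and> tail G (f 0) = w"
  then obtain g where g: "biinfinite_walk G g" "tail G (g 0) = v"
    "((\<lambda>i. l (g i)), (\<lambda>i. l (f i))) \<in> ?R\<^sup>*"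
    using vw unfolding chain_leads_def by blast
  then obtain e where "biinfinite_walk G e" "tail G (e 0) = u"
    "((\<lambda>i. l (e i)), (\<lambda>i. l (g i))) \<in> ?R\<^sup>*"
    using uv unfolding chain_leads_def by blast
  then show "\<exists>e. biinfinite_walk G e \<and> tail G (e 0) = u \<and>
      ((\<lambda>i. l (e i)), (\<lambda>i. l (f i))) \<in> ?R\<^sup>*"
    using rtrancl_trans[OF _ g(3)] by blast
qed

lemma overlap_steps_along_walk:
  assumes "biinfinite_walk G e" "biinfinite_walk G f" "k > 0"
    and "\<And>t. 0 \<le> t \<Longrightarrow> t < int N \<Longrightarrow> l (e (t + int k)) = l (f t)"
  shows "((\<lambda>i. l (e i)), (\<lambda>i. l (f i))) \<in> (overlap_step (graph_shift G l) N)\<^sup>+"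
  by (rule overlap_steps_along_orbit[where k = k, OF shift_map_graph_shift graph_shiftI[OF assms(1)]
      graph_shiftI[OF assms(2)] assms(3) assms(4)])

lemma (in wf_digraph) chain_leads_arc:
  assumes ess: "essential G" and "(u, w) \<in> arcs_ends G"
  shows "chain_leads G l N u w"
  unfolding chain_leads_def
proof (intro allI impI)
  fix f assume f: "biinfinite_walk G f \<and> tail G (f 0) = w"
  obtain a where a: "a \<in> arcs G" "tail G a = u" "head G a = w"
    using assms(2) by (auto simp: arcs_ends_def arc_to_ends_def)
  then have "awalk u [a] w" by (auto simp: awalk_simps)
  then obtain e where e: "biinfinite_walk G e" "tail G (e 0) = u"
    and ef: "\<And>i. i \<ge> 0 \<Longrightarrow> e (i + int (length [a])) = f i"
    using awalk_extend_biinfinite_walk[OF ess] f by metis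
  have "((\<lambda>i. l (e i)), (\<lambda>i. l (f i))) \<in> (overlap_step (graph_shift G l) N)\<^sup>+"
    using e(1) f by (intro overlap_steps_along_walk[where k = 1]) (use ef in auto)
  then show "\<exists>e. biinfinite_walk G e \<and> tail G (e 0) = u \<and>
      ((\<lambda>i. l (e i)), (\<lambda>i. l (f i))) \<in> (overlap_step (graph_shift G l) N)\<^sup>*"
    using e by (blast intro: trancl_into_rtrancl)
qed

text \<open>Let \<open>p\<close> and \<open>q\<close> read the same long word from \<open>u\<close> and from \<open>w\<close>, and let \<open>r\<close> lead from the end
  of \<open>q\<close> back to \<open>w\<close>. Begin with a point that follows \<open>p\<close>; the first step already replaces it by
  one that follows \<open>q\<close>, then \<open>r\<close>, then the given walk from \<open>w\<close>.\<close>

lemma (in wf_digraph) chain_leads_linked: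
  fixes l :: "'b \<Rightarrow> 'c::finite"
  assumes ess: "essential G" and "(u, w) \<in> linked G l"
  shows "chain_leads G l N u w"
  unfolding chain_leads_def
proof (intro allI impI)
  fix f assume f: "biinfinite_walk G f \<and> tail G (f 0) = w"
  have "infinite (follower_set G l u \<inter> follower_set G l w)" using assms(2) by (simp add: linked_def)
  \<comment> \<open>the first step consumes one letter and reads \<open>N\<close> more; one further letter ensures that the
    steps along \<open>g\<close> below are at least one\<close>
  then obtain s where s: "s \<in> follower_set G l u" "s \<in> follower_set G l w" "length s \<ge> N + 2"
    by (rule infinite_imp_long_word) auto
  obtain p u' where p: "awalk u p u'" "s = map l p"
    using s(1) unfolding follower_set_eq by blast
  obtain q w' r where q: "awalk w q w'" "s = map l q" and r: "awalk w' r w"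
    using s(2) unfolding follower_set_eq reachable_awalk by blast
  obtain f' where f': "biinfinite_walk G f'" "tail G (f' 0) = u'"
    using essential_biinfinite_walk_from[OF ess] p awalk_last_in_verts by metis
  obtain e where e: "biinfinite_walk G e" "tail G (e 0) = u"
    and ep: "\<And>k. k < length p \<Longrightarrow> e (int k) = p ! k"
    using awalk_extend_biinfinite_walk[OF ess p(1) f'] by metis
  obtain g where g: "biinfinite_walk G g"
    and gq: "\<And>k. k < length (q @ r) \<Longrightarrow> g (int k) = (q @ r) ! k"
    and gf: "\<And>i. i \<ge> 0 \<Longrightarrow> g (i + int (length (q @ r))) = f i"
    using awalk_extend_biinfinite_walk[OF ess awalk_appendI[OF q(1) r]] f by metis
  have len: "length p = length s" "length q = length s"
    using arg_cong[OF p(2), of length] arg_cong[OF q(2), of length] by simp_all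
  have eg: "l (e t) = l (g t)" if "0 \<le> t" "t < int (length s)" for t
  proof -
    have t: "nat t < length p" "nat t < length q" using that len by linarith+
    then have "l (e t) = s ! nat t" using ep[of "nat t"] that unfolding p(2) by simp
    also have "\<dots> = l (g t)"
      using gq[of "nat t"] that t unfolding q(2) by (simp add: nth_append)
    finally show ?thesis .
  qed
  have "((\<lambda>i. l (e i)), (\<lambda>i. l (g (i + 1)))) \<in> (overlap_step (graph_shift G l) N)\<^sup>+"
    using e(1) biinfinite_walk_shift[OF g, of 1] eg s(3)
    by (intro overlap_steps_along_walk[where k = 1]) auto
  moreover have "((\<lambda>i. l (g (i + 1))), (\<lambda>i. l (f i))) \<in> (overlap_step (graph_shift G l) N)\<^sup>+"
  proof (rule overlap_steps_along_walk[where k = "length (q @ r) - 1"])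
    have pos: "length (q @ r) \<ge> 2" using s(3) len by simp
    then show "length (q @ r) - 1 > 0" by linarith
    show "l (g (t + int (length (q @ r) - 1) + 1)) = l (f t)" if "0 \<le> t" for t
    proof -
      have "t + int (length (q @ r) - 1) + 1 = t + int (length (q @ r))" using pos by linarith
      then show ?thesis using gf[OF that] by simp
    qed
  qed (use biinfinite_walk_shift[OF g, of 1] f in simp_all)
  ultimately show "\<exists>e. biinfinite_walk G e \<and> tail G (e 0) = u \<and>
      ((\<lambda>i. l (e i)), (\<lambda>i. l (f i))) \<in> (overlap_step (graph_shift G l) N)\<^sup>*"
    using e by (blast intro: trancl_trans trancl_into_rtrancl)
qed

lemma (in wf_digraph) chain_transitive_if_linking_connected:
  fixes l :: "'b \<Rightarrow> 'c::finite"
  assumes ess: "essential G"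
    and conn: "\<forall>u\<in>verts G. \<forall>w\<in>verts G. (u, w) \<in> (arcs_ends G \<union> linked G l)\<^sup>*"
  shows "chain_transitive (graph_shift G l)"
  unfolding chain_transitive_iff_overlap_step[OF shift_map_graph_shift]
proof (intro ballI allI)
  fix x y N assume "x \<in> graph_shift G l" "y \<in> graph_shift G l"
  then obtain e f where e: "biinfinite_walk G e" "x = (\<lambda>i. l (e i))"
    and f: "biinfinite_walk G f" "y = (\<lambda>i. l (f i))"
    by (auto simp: graph_shift_def)
  let ?R = "overlap_step (graph_shift G l) N"
  \<comment> \<open>the window after one step covers the coordinates \<open>1, \<dots>, N\<close> of \<open>x\<close>, so the presentation may be
    exchanged from coordinate \<open>N + 1\<close> on; one more arc keeps the number \<open>N + 1\<close> of steps that lead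
    from there to \<open>g\<close> positive even for \<open>N = 0\<close>\<close>
  define w where "w = tail G (e (int N + 2))"
  have "chain_leads G l N u v" if "(u, v) \<in> (arcs_ends G \<union> linked G l)\<^sup>*" for u v
    using that
  proof (induction rule: rtrancl_induct)
    case base
    show ?case by (rule chain_leads_refl)
  next
    case (step v v')
    then have "chain_leads G l N v v'"
      using chain_leads_arc[OF ess] chain_leads_linked[OF ess] by (metis UnE)
    with step.IH show ?case by (rule chain_leads_trans)
  qed
  then have "chain_leads G l N w (tail G (f 0))"
    using conn e f biinfinite_walk_tail_in_verts unfolding w_def by blast
  then obtain g where g: "biinfinite_walk G g" "tail G (g 0) = w"
    and gf: "((\<lambda>i. l (g i)), y) \<in> ?R\<^sup>*"
    using f unfolding chain_leads_def by blast
  define h where "h i = (if i < int N + 2 then e i else g (i - (int N + 2)))" for i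
  have h: "biinfinite_walk G h"
    unfolding h_def using biinfinite_walk_paste[OF e(1) g(1)] g(2) by (simp add: w_def)
  have "(x, (\<lambda>i. l (h (i + 1)))) \<in> ?R\<^sup>+"
    unfolding e(2) using e(1) biinfinite_walk_shift[OF h, of 1]
    by (intro overlap_steps_along_walk[where k = 1]) (auto simp: h_def)
  moreover have "((\<lambda>i. l (h (i + 1))), (\<lambda>i. l (g i))) \<in> ?R\<^sup>+"
    using biinfinite_walk_shift[OF h, of 1] g(1)
    by (intro overlap_steps_along_walk[where k = "N + 1"]) (auto simp: h_def algebra_simps)
  ultimately show "(x, y) \<in> ?R\<^sup>+"
    using gf by (meson trancl_rtrancl_trancl trancl_trans)
qed

section \<open>Chain-transitivity makes the linking graph connected\<close>

lemma (in fin_digraph) linking_connected_if_chain_transitive: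
  assumes ess: "essential G" and trans: "chain_transitive (graph_shift G l)"
    and u: "u \<in> verts G" and w: "w \<in> verts G"
  shows "(u, w) \<in> (arcs_ends G \<union> linked G l)\<^sup>*"
proof -
  obtain D where "D > 0" and
    linkD: "\<And>e f a b. \<lbrakk>biinfinite_walk G e; biinfinite_walk G f;
        \<And>s. 0 \<le> s \<Longrightarrow> s < int D \<Longrightarrow> l (e (a + s)) = l (f (b + s))\<rbrakk>
      \<Longrightarrow> \<exists>s. 0 \<le> s \<and> s \<le> int D \<and> (tail G (e (a + s)), tail G (f (b + s))) \<in> linked G l"
    using presentations_linked_in_window by blast
  define S where "S = {v. (u, v) \<in> (arcs_ends G \<union> linked G l)\<^sup>*}"
  have S_linked: "v' \<in> S" if "v \<in> S" "(v, v') \<in> linked G l" for v v'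
    using that unfolding S_def by (auto intro: rtrancl_into_rtrancl)
  have S_reach: "v' \<in> S" if "v \<in> S" "v \<rightarrow>\<^sup>* v'" for v v'
  proof -
    have "(v, v') \<in> (arcs_ends G)\<^sup>*" using that(2) by (rule reachable_rtranclI)
    then have "(v, v') \<in> (arcs_ends G \<union> linked G l)\<^sup>*"
      by (rule rtrancl_mono[THEN subsetD, rotated]) simp
    then show ?thesis using that(1) unfolding S_def by (auto intro: rtrancl_trans)
  qed
  obtain e where e: "biinfinite_walk G e" "tail G (e 0) = u"
    using essential_biinfinite_walk_from[OF ess u] by blast
  obtain f0 where f0: "biinfinite_walk G f0" "tail G (f0 0) = w"
    using essential_biinfinite_walk_from[OF ess w] by blast
  \<comment> \<open>\<open>f\<close> is at \<open>w\<close> at the end of the window\<close>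
  define f where "f i = f0 (i + - 2 * int D)" for i
  have f: "biinfinite_walk G f" "tail G (f (2 * int D)) = w"
    unfolding f_def using biinfinite_walk_shift[OF f0(1), of "- 2 * int D"] f0(2) by simp_all
  let ?R = "overlap_step (graph_shift G l) (2 * D)"
  have "((\<lambda>i. l (e i)), (\<lambda>i. l (f i))) \<in> ?R\<^sup>+"
    using trans graph_shiftI[OF e(1)] graph_shiftI[OF f(1)]
    unfolding chain_transitive_iff_overlap_step[OF shift_map_graph_shift] by blast
  then obtain n c where n: "n > 0" and c0: "c 0 = (\<lambda>i. l (e i))" and cn: "c n = (\<lambda>i. l (f i))"
    and step: "\<And>i. i < n \<Longrightarrow> (c i, c (Suc i)) \<in> ?R"
    unfolding trancl_power relpow_fun_conv by auto
  have "\<exists>h. biinfinite_walk G h \<and> (\<forall>t. l (h t) = c i t)" if "0 < i" "i < n" for i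
    using step[of i] that by (auto simp: overlap_step_def graph_shift_def)
  then obtain h0 where h0: "\<And>i. 0 < i \<Longrightarrow> i < n \<Longrightarrow> biinfinite_walk G (h0 i) \<and> (\<forall>t. l (h0 i t) = c i t)"
    by metis
  \<comment> \<open>presentations of the points of the chain may be arbitrary, except for the first and the last\<close>
  define h where "h i = (if i = 0 then e else if i = n then f else h0 i)" for i
  have h: "biinfinite_walk G (h i)" "l (h i t) = c i t" if "i \<le> n" for i t
    using h0[of i] that e f c0 cn n by (auto simp: h_def)
  have agree: "l (h i (t + int r)) = l (h (i + r) t)"
    if "i + r \<le> n" "0 \<le> t" "t + int r \<le> 2 * int D" for i r t
    using that
  proof (induction r arbitrary: t)
    case (Suc r)
    have "(c (i + r), c (Suc (i + r))) \<in> ?R" using step Suc.prems by simp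
    then have "c (i + r) (t + 1) = c (Suc (i + r)) t"
      using Suc.prems by (simp add: overlap_step_def)
    then show ?case using Suc.IH[of "t + 1"] Suc.prems h(2) by (simp add: add_ac)
  qed simp
  \<comment> \<open>the two presentations share the word at the times \<open>D, \<dots>, 2 * D - 1\<close> of \<open>h i\<close>, which are
    the times \<open>D - r, \<dots>, 2 * D - r - 1\<close> of \<open>h (i + r)\<close>\<close>
  have late: "tail G (h (i + r) (2 * int D - int r)) \<in> S"
    if "i + r \<le> n" "r \<le> D" "tail G (h i (int D)) \<in> S" for i r
  proof -
    let ?b = "int D - int r"
    have "\<exists>s. 0 \<le> s \<and> s \<le> int D \<and> (tail G (h i (int D + s)), tail G (h (i + r) (?b + s))) \<in> linked G l"
    proof (rule linkD)
      show "l (h i (int D + s)) = l (h (i + r) (?b + s))" if "0 \<le> s" "s < int D" for s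
        using agree[of i r "?b + s"] that \<open>i + r \<le> n\<close> \<open>r \<le> D\<close> by (simp add: algebra_simps)
    qed (use h that in auto)
    then obtain s where s: "0 \<le> s" "s \<le> int D"
      and "(tail G (h i (int D + s)), tail G (h (i + r) (?b + s))) \<in> linked G l" by blast
    moreover have "tail G (h i (int D + s)) \<in> S"
      using that s h by (intro S_reach[OF that(3)] biinfinite_walk_reachable) auto
    ultimately have "tail G (h (i + r) (?b + s)) \<in> S" using S_linked by blast
    moreover have "tail G (h (i + r) (?b + s)) \<rightarrow>\<^sup>* tail G (h (i + r) (2 * int D - int r))"
      using s h that by (intro biinfinite_walk_reachable) auto
    ultimately show ?thesis by (rule S_reach)
  qed
  \<comment> \<open>\<open>late\<close> with \<open>r = D\<close> reproduces its own hypothesis\<close>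
  have mult: "tail G (h (k * D) (int D)) \<in> S" if "k * D \<le> n" for k
    using that
  proof (induction k)
    case 0
    have "u \<in> S" by (simp add: S_def)
    then show ?case using S_reach biinfinite_walk_reachable[OF e(1), of 0 "int D"] e(2)
      by (simp add: h_def)
  next
    case (Suc k)
    then show ?case using late[of "k * D" D] by (simp add: add.commute)
  qed
  have nD: "n = n div D * D + n mod D" by simp
  have "tail G (h n (2 * int D - int (n mod D))) \<in> S"
    using late[of "n div D * D" "n mod D"] mult[of "n div D"] \<open>D > 0\<close> nD
    by (simp add: less_imp_le)
  moreover have "tail G (h n (2 * int D - int (n mod D))) \<rightarrow>\<^sup>* tail G (h n (2 * int D))"
    using h by (intro biinfinite_walk_reachable) auto
  ultimately have "tail G (h n (2 * int D)) \<in> S" by (rule S_reach)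
  then show ?thesis using f n by (simp add: h_def S_def)
qed

section \<open>Chain-transitive graph languages\<close>

theorem mainTheorem2:
  fixes G :: "('v, 'e) pre_digraph" and l :: "'e \<Rightarrow> 'a::finite"
  assumes "fin_digraph G" and "essential G"
  shows "chain_transitive_language (graph_language G l) \<longleftrightarrow> walk_connected (linking_graph G l)"
proof -
  interpret fin_digraph G by fact
  have "chain_transitive_language (graph_language G l) \<longleftrightarrow> chain_transitive (graph_shift G l)"
    unfolding chain_transitive_language_def graph_language_def
    using subshift_graph_shift[of l] language_inj by metis
  also have "\<dots> \<longleftrightarrow> (\<forall>u\<in>verts G. \<forall>w\<in>verts G. (u, w) \<in> (arcs_ends G \<union> linked G l)\<^sup>*)"
    using chain_transitive_if_linking_connected linking_connected_if_chain_transitive assms(2)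
    by blast
  also have "\<dots> \<longleftrightarrow> walk_connected (linking_graph G l)"
    using walk_connected_linking_graph_iff wf_digraph_axioms by blast
  finally show ?thesis .
qed

end
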